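(* Let $F$ be an algebraically closed field of characteristic $0$ and let $l=4$ or $l=9$. Then for all integers $r$ and all integers $k\ge0$, $h(l,r;k)=c(l,r;k)$; equivalently $H_{l,r}=C_{l,r}$.
   Context: Let $S=F[x,y,z]=\bigoplus_kS^k$, $S^j=0$ for $j<0$. For points $p_1,\dots,p_l\in F^3\setminus\{0\}$, $h(\mathbf p;r;k)=\dim_F S^k/\sum_{i=1}^lS^{k-r}p_i^{r}$, and $h(l,r;k)$ is the minimum of this over all $\mathbf p$ (the value for $l$ generic points of $\mathbb P^2$, all with the same exponent $r$), with $h(l,r;k)=0$ if $r<0$. $c(l,r;k)=\operatorname{trunc}\bigl(\binom{k+2}{2}-l\binom{k-r+2}{2}\bigr)$ if $r\le k$ and $c(l,r;k)=\binom{k+2}{2}$ if $r>k$, where $\operatorname{trunc}(x)=x$ if $x>0$ and $0$ otherwise. $H_{l,r}(q)=\sum_k h(l,r;k)q^k$ and $C_{l,r}(q)=\sum_kc(l,r;k)q^k$. *)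

theory Defs
  imports "HOL-Computational_Algebra.Polynomial" "HOL-Library.Function_Algebras"
begin

text \<open>Ternary forms over a field 'a: elements of S = F[x,y,z] are represented by their
coefficient functions on exponent triples (i,j,l), standing for x^i y^j z^l.\<close>

type_synonym 'a form = "nat \<times> nat \<times> nat \<Rightarrow> 'a"

definition mdeg :: "nat \<times> nat \<times> nat \<Rightarrow> nat" where
  "mdeg m = (case m of (a, b, c) \<Rightarrow> a + b + c)"

definition fscale :: "'a::field \<Rightarrow> 'a form \<Rightarrow> 'a form" where
  "fscale c f = (\<lambda>m. c * f m)"

lemma vector_space_fscale: "vector_space (fscale :: 'a::field \<Rightarrow> 'a form \<Rightarrow> 'a form)"
  by unfold_locales (auto simp: fscale_def fun_eq_iff algebra_simps)

definition pmul :: "'a::field form \<Rightarrow> 'a form \<Rightarrow> 'a form" where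
  "pmul f g = (\<lambda>(a, b, c). \<Sum>i\<le>a. \<Sum>j\<le>b. \<Sum>k\<le>c. f (i, j, k) * g (a - i, b - j, c - k))"

definition pone :: "'a::field form" where
  "pone = (\<lambda>m. if m = (0, 0, 0) then 1 else 0)"

definition mono :: "nat \<times> nat \<times> nat \<Rightarrow> 'a::field form" where
  "mono m = (\<lambda>m'. if m' = m then 1 else 0)"

definition linform :: "'a::field \<times> 'a \<times> 'a \<Rightarrow> 'a form" where
  "linform p = (\<lambda>m. if m = (1, 0, 0) then fst p
                   else if m = (0, 1, 0) then fst (snd p)
                   else if m = (0, 0, 1) then snd (snd p) else 0)"

definition lpow :: "'a::field \<times> 'a \<times> 'a \<Rightarrow> nat \<Rightarrow> 'a form" where
  "lpow p r = (pmul (linform p) ^^ r) pone"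

text \<open>generators of \<Sum>_i S^{k-r} p_i^r (r \<ge> 0): monomials of degree k-r times p_i^r;
  empty if r > k since S^j = 0 for j < 0\<close>
definition gens :: "(nat \<Rightarrow> 'a::field \<times> 'a \<times> 'a) \<Rightarrow> nat \<Rightarrow> int \<Rightarrow> nat \<Rightarrow> 'a form set" where
  "gens p l r k = (if r > int k then {}
     else {pmul (mono m) (lpow (p i) (nat r)) | m i. mdeg m = k - nat r \<and> i < l})"

text \<open>h(p;r;k) = dim S^k - dim (\<Sum>_i S^{k-r} p_i^r); dim S^k = number of monomials of degree k\<close>
definition hpts :: "(nat \<Rightarrow> 'a::field \<times> 'a \<times> 'a) \<Rightarrow> nat \<Rightarrow> int \<Rightarrow> nat \<Rightarrow> nat" where
  "hpts p l r k = card {m. mdeg m = k} - vector_space.dim fscale (gens p l r k)"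

definition hgen :: "'a::field itself \<Rightarrow> nat \<Rightarrow> int \<Rightarrow> nat \<Rightarrow> nat" where
  "hgen _ l r k = (if r < 0 then 0 else
     (LEAST n. \<exists>p :: nat \<Rightarrow> 'a \<times> 'a \<times> 'a. (\<forall>i<l. p i \<noteq> (0, 0, 0)) \<and> n = hpts p l r k))"

definition trunc :: "int \<Rightarrow> nat" where
  "trunc x = (if x > 0 then nat x else 0)"

definition cfun :: "nat \<Rightarrow> int \<Rightarrow> nat \<Rightarrow> nat" where
  "cfun l r k = (if r \<le> int k
     then trunc (int ((k + 2) choose 2) - int l * int ((nat (int k - r) + 2) choose 2))
     else (k + 2) choose 2)"

end

(* Macaulay duality: a functional on S^k killing all S^(k-r) p_i^r is the same as a polynomial
   of degree at most k in two affine variables vanishing to order k-r+1 at the points p_i.  It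
   therefore suffices to find one configuration for which the space of such polynomials has at
   most the expected dimension; the converse inequality is a count of generators.

   For l = s^2 take s points on each of the s parallel lines y = 0, ..., s-1.  With m = k-r+1,
   the restriction of a solution to a line has at most max 0 (k+1-sm) free coefficients, and if
   it vanishes, dividing by the equation of the line lowers the degree and the multiplicities on
   that line by one.  Passing through all s lines lowers (k, m) to (k-s, m-1), and the bounds
   obtained add up to the expected dimension, except for s = 3 and k = 3m.  There the three
   restrictions are multiples c_j * prod_i (x - a_ij)^m; comparing the coefficients of x^(3m)
   and x^(3m-1) gives c_0 = c_1 = c_2 = c, with c * m * sum_i a_ij affine in j, so c = 0 as
   soon as the sums of the a_ij are not in arithmetic progression.  Hence only the m-th power
   of the cubic through the nine points survives. *)
theory Submission
  imports Defs
begin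

section \<open>Fat points and division by a line\<close>

text \<open>The outer variable of a \<open>poly poly\<close> is y and the inner one is x. The bound
  is strict, so that \<open>K = 0\<close> leaves only the zero polynomial and truncated subtraction
  \<open>K - 1\<close> is right at \<open>K = 0\<close> too.\<close>

definition tdeg_less :: "nat \<Rightarrow> 'a::field poly poly \<Rightarrow> bool" where
  "tdeg_less K f \<longleftrightarrow> (\<forall>i j. K \<le> i + j \<longrightarrow> coeff (coeff f j) i = 0)"

text \<open>Multiplicity at least n at the point (a, b): in the expansion by powers of y - b, the
  coefficient of the i-th power must be divisible by (x - a) to the power n - i. This is membership
  in the n-th power of the ideal of the point.\<close>

definition vanish :: "nat \<Rightarrow> 'a::field \<Rightarrow> 'a \<Rightarrow> 'a poly poly \<Rightarrow> bool" where
  "vanish n a b f \<longleftrightarrow> (\<forall>i<n. [:-a, 1:] ^ (n - i) dvd coeff (f \<circ>\<^sub>p [:[:b:], 1:]) i)"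

lemma tdeg_less_0: "tdeg_less 0 f \<Longrightarrow> f = 0"
  by (auto simp: tdeg_less_def poly_eq_iff)

lemma tdeg_less_pCons:
  "tdeg_less K (pCons a f) \<longleftrightarrow> (\<forall>i\<ge>K. coeff a i = 0) \<and> tdeg_less (K - 1) f" (is "?l \<longleftrightarrow> ?r")
proof
  assume l: ?l
  show ?r
  proof (intro conjI allI impI)
    fix i assume "i \<ge> K" with l show "coeff a i = 0"
      unfolding tdeg_less_def by (metis add.right_neutral coeff_pCons_0)
  next
    show "tdeg_less (K - 1) f"
      unfolding tdeg_less_def
    proof (intro allI impI)
      fix i j assume "K - 1 \<le> i + j"
      then have "K \<le> i + Suc j" by simp
      with l show "coeff (coeff f j) i = 0" unfolding tdeg_less_def by (metis coeff_pCons_Suc)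
    qed
  qed
next
  assume r: ?r
  show ?l
    unfolding tdeg_less_def
  proof (intro allI impI)
    fix i j assume "K \<le> i + j"
    with r show "coeff (coeff (pCons a f) j) i = 0"
      by (cases j) (auto simp: tdeg_less_def)
  qed
qed

text \<open>Restricting to the horizontal line y = b does not raise the degree.\<close>

lemma coeff_poly_const:
  assumes "tdeg_less K f" "K \<le> i"
  shows "coeff (poly f [:b:]) i = 0"
  using assms
proof (induction f arbitrary: K)
  case (pCons a f)
  then have "coeff a i = 0" "coeff (poly f [:b:]) i = 0"
    using pCons.IH[of "K - 1"] by (auto simp: tdeg_less_pCons)
  then show ?case by simp
qed simp

lemma tdeg_less_synthetic_div:
  "tdeg_less K f \<Longrightarrow> tdeg_less (K - 1) (synthetic_div f [:b:])"
proof (induction f arbitrary: K)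
  case 0
  then show ?case by (simp add: tdeg_less_def)
next
  case (pCons a p)
  then have p: "tdeg_less (K - 1) p" by (simp add: tdeg_less_pCons)
  then show ?case
    using pCons.IH[OF p] coeff_poly_const[OF p] by (simp add: tdeg_less_pCons)
qed

lemma synthetic_div_root:
  "poly f c = 0 \<Longrightarrow> f = [:-c, 1:] * synthetic_div f c" for c :: "'a::comm_ring_1"
  using synthetic_div_correct'[of c f] by simp

text \<open>Taking the quotient is linear even where the remainder is nonzero, so linear functionals
  on quotients pull back to linear functionals on all polynomials.\<close>

lemma synthetic_div_add:
  "synthetic_div (f + g) c = synthetic_div f c + synthetic_div g c" for c :: "'a::comm_ring_1"
proof -
  have "f + g + smult c (synthetic_div f c + synthetic_div g c)
      = pCons (poly f c + poly g c) (synthetic_div f c + synthetic_div g c)"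
    using synthetic_div_correct[of f c] synthetic_div_correct[of g c]
    by (simp add: smult_add_right algebra_simps flip: add_pCons)
       (metis add.assoc add.left_commute)
  from synthetic_div_unique[OF this] show ?thesis by simp
qed

lemma synthetic_div_smult:
  "synthetic_div (smult a f) c = smult a (synthetic_div f c)" for c :: "'a::comm_ring_1"
proof -
  have "smult a f + smult c (smult a (synthetic_div f c))
      = smult a (f + smult c (synthetic_div f c))"
    by (simp add: smult_add_right mult.commute)
  also have "\<dots> = pCons (a * poly f c) (smult a (synthetic_div f c))"
    by (simp add: synthetic_div_correct)
  finally show ?thesis using synthetic_div_unique by metis
qed

text \<open>After the shift the line through the point is y = 0, so division moves every coefficient
  down by one index, and n - (i + 1) = (n - 1) - i.\<close>

lemma vanish_synthetic_div_same:
  assumes "vanish n a b f" "poly f [:b:] = 0"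
  shows "vanish (n - 1) a b (synthetic_div f [:b:])"
proof -
  define g where "g = synthetic_div f [:b:] \<circ>\<^sub>p [:[:b:], 1:]"
  have "f \<circ>\<^sub>p [:[:b:], 1:] = ([:-[:b:], 1:] \<circ>\<^sub>p [:[:b:], 1:]) * g"
    by (subst synthetic_div_root[OF assms(2)]) (simp only: pcompose_mult g_def)
  also have "[:-[:b:], 1:] \<circ>\<^sub>p [:[:b:], 1:] = [:0, 1:]" by (simp add: pcompose_pCons)
  finally have eq: "f \<circ>\<^sub>p [:[:b:], 1:] = pCons 0 g" by simp
  show ?thesis
    unfolding vanish_def g_def[symmetric]
  proof (intro allI impI)
    fix i assume "i < n - 1"
    then have "[:-a, 1:] ^ (n - Suc i) dvd coeff (pCons 0 g) (Suc i)"
      using assms(1) by (auto simp: vanish_def eq simp del: coeff_pCons_Suc)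
    then show "[:-a, 1:] ^ (n - 1 - i) dvd coeff g i" by simp
  qed
qed

text \<open>After the shift the divisor is y + d with d nonzero, a unit at the point. The
  coefficients of the quotient are recovered one after another from d * g_(i+1) + g_i; the induction
  works because the required power of x - a decreases with i.\<close>

lemma vanish_synthetic_div_other:
  assumes "vanish n a b f" "poly f [:b':] = 0" "b \<noteq> b'"
  shows "vanish n a b (synthetic_div f [:b':])"
proof -
  define g where "g = synthetic_div f [:b':] \<circ>\<^sub>p [:[:b:], 1:]"
  define d where "d = b - b'"
  have d: "d \<noteq> 0" using assms by (simp add: d_def)
  have "f \<circ>\<^sub>p [:[:b:], 1:] = ([:-[:b':], 1:] \<circ>\<^sub>p [:[:b:], 1:]) * g"
    by (subst synthetic_div_root[OF assms(2)]) (simp only: pcompose_mult g_def)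
  also have "[:-[:b':], 1:] \<circ>\<^sub>p [:[:b:], 1:] = [:[:d:], 1:]"
    by (simp add: pcompose_pCons d_def)
  finally have eq: "f \<circ>\<^sub>p [:[:b:], 1:] = smult [:d:] g + pCons 0 g" by simp
  have "[:-a, 1:] ^ (n - i) dvd coeff g i" if "i < n" for i
    using that
  proof (induction i)
    case 0
    then have "[:-a, 1:] ^ n dvd smult d (coeff g 0)"
      using assms(1) by (force simp: vanish_def eq)
    then show ?case using d by (simp add: dvd_smult_iff)
  next
    case (Suc i)
    have "[:-a, 1:] ^ (n - Suc i) dvd [:-a, 1:] ^ (n - i)" by (simp add: le_imp_power_dvd)
    also have "\<dots> dvd coeff g i" using Suc by simp
    finally have 1: "[:-a, 1:] ^ (n - Suc i) dvd coeff g i" .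
    have "[:-a, 1:] ^ (n - Suc i) dvd smult d (coeff g (Suc i)) + coeff g i"
      using assms(1) Suc.prems by (force simp: vanish_def eq)
    with 1 have "[:-a, 1:] ^ (n - Suc i) dvd smult d (coeff g (Suc i))"
      by (simp add: dvd_add_left_iff)
    then show ?case using d by (simp add: dvd_smult_iff)
  qed
  then show ?thesis unfolding vanish_def g_def by blast
qed

text \<open>The points are (A i j, j), s of them on each line y = j. The multiplicity is allowed to
  depend on the line because the lines are divided out one at a time.\<close>

definition fat_polys ::
    "nat \<Rightarrow> nat \<Rightarrow> (nat \<Rightarrow> nat \<Rightarrow> 'a::field) \<Rightarrow> (nat \<Rightarrow> nat) \<Rightarrow> 'a poly poly set" where
  "fat_polys K s A ms =
     {f. tdeg_less K f \<and> (\<forall>j<s. \<forall>i<s. vanish (ms j) (A i j) (of_nat j) f)}"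

lemma fat_polys_synthetic_div:
  fixes A :: "nat \<Rightarrow> nat \<Rightarrow> 'a::field_char_0"
  assumes "f \<in> fat_polys K s A ms" "poly f [:of_nat j:] = 0" "j < s"
  shows "synthetic_div f [:of_nat j:] \<in> fat_polys (K - 1) s A (ms(j := ms j - 1))"
  using assms
  using tdeg_less_synthetic_div[of K f "of_nat j"] vanish_synthetic_div_same[of "ms j" _ "of_nat j" f]
  by (auto simp: fat_polys_def vanish_synthetic_div_other)

text \<open>Powers of distinct linear factors are coprime: the product over the other points has
  order 0 at \<open>a x\<close>, so the whole order of h there falls on the cofactor q.\<close>

lemma prod_linear_powers_dvd:
  fixes h :: "'a::field poly"
  assumes "inj_on a I" "finite I" "\<And>i. i \<in> I \<Longrightarrow> [:-a i, 1:] ^ n dvd h"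
  shows "(\<Prod>i\<in>I. [:-a i, 1:]) ^ n dvd h"
  using assms(2,1,3)
proof (induction I rule: finite_induct)
  case empty
  then show ?case by simp
next
  case (insert x I)
  then obtain q where q: "h = (\<Prod>i\<in>I. [:-a i, 1:]) ^ n * q" by (auto simp: inj_on_def elim: dvdE)
  have "[:-a x, 1:] ^ n dvd q"
  proof (cases "h = 0")
    case False
    have "poly ((\<Prod>i\<in>I. [:-a i, 1:]) ^ n) (a x) \<noteq> 0"
      using insert.hyps insert.prems(1) by (auto simp: poly_prod inj_on_def)
    then have "order (a x) ((\<Prod>i\<in>I. [:-a i, 1:]) ^ n) = 0" by (rule order_0I)
    moreover have "n \<le> order (a x) h"
      using insert.prems(2)[of x] False by (auto simp: order_divides)
    ultimately show ?thesis
      using False order_mult[of "(\<Prod>i\<in>I. [:-a i, 1:]) ^ n" q "a x"] q by (auto simp: order_divides)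
  qed (use q in \<open>auto simp: prod_zero_iff insert.hyps\<close>)
  then show ?case
    unfolding q prod.insert[OF insert.hyps] power_mult_distrib
    by (subst mult.commute) (intro mult_dvd_mono dvd_refl)
qed

section \<open>Dimension bounds for fat points on parallel lines\<close>

text \<open>Setting y = j leaves the constant coefficient of the shifted polynomial, which carries
  the full power \<open>ms j\<close> at each of the s distinct abscissae.\<close>

lemma fat_polys_restrict_dvd:
  assumes "f \<in> fat_polys K s A ms" "j < s" "inj_on (\<lambda>i. A i j) {..<s}"
  shows "(\<Prod>i<s. [:-A i j, 1:]) ^ ms j dvd poly f [:of_nat j:]"
proof (cases "ms j = 0")
  case False
  show ?thesis
  proof (rule prod_linear_powers_dvd[OF assms(3)])
    fix i assume "i \<in> {..<s}"
    then have "vanish (ms j) (A i j) (of_nat j) f" using assms(1,2) by (simp add: fat_polys_def)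
    then have "[:-A i j, 1:] ^ (ms j - 0) dvd coeff (f \<circ>\<^sub>p [:[:of_nat j:], 1:]) 0"
      using False unfolding vanish_def by blast
    also have "coeff (f \<circ>\<^sub>p [:[:of_nat j:], 1:]) 0 = poly f [:of_nat j:]"
      by (simp add: poly_pcompose flip: poly_0_coeff_0)
    finally show "[:-A i j, 1:] ^ ms j dvd poly f [:of_nat j:]" by simp
  qed simp
qed simp

definition plinear :: "('a::field poly poly \<Rightarrow> 'a) \<Rightarrow> bool" where
  "plinear L \<longleftrightarrow> (\<forall>f g. L (f + g) = L f + L g) \<and> (\<forall>c f. L (smult [:c:] f) = c * L f)"

text \<open>For a subspace this says that its dimension is at most \<open>N\<close>.\<close>

definition separated :: "nat \<Rightarrow> 'a::field poly poly set \<Rightarrow> bool" where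
  "separated N U \<longleftrightarrow> (\<exists>\<Lambda>. finite \<Lambda> \<and> card \<Lambda> \<le> N \<and> (\<forall>L\<in>\<Lambda>. plinear L) \<and>
     (\<forall>f\<in>U. (\<forall>L\<in>\<Lambda>. L f = 0) \<longrightarrow> f = 0))"

text \<open>Dimension count along restriction to line j: the kernel embeds by division into the
  smaller system, and the coefficients with index in T detect whether the restriction vanishes. The
  functionals are those of the quotient, pulled back along \<open>synthetic_div\<close>, together
  with these coefficients.\<close>

lemma separated_divide:
  fixes A :: "nat \<Rightarrow> nat \<Rightarrow> 'a::field_char_0"
  assumes sep: "separated N (fat_polys (K - 1) s A (ms(j := ms j - 1)))" and j: "j < s"
    and T: "\<And>f. f \<in> fat_polys K s A ms \<Longrightarrow> (\<forall>t\<in>T. coeff (poly f [:of_nat j:]) t = 0) \<Longrightarrow> poly f [:of_nat j:] = 0"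
    and fin: "finite T"
  shows "separated (N + card T) (fat_polys K s A ms)"
proof -
  obtain \<Lambda> where \<Lambda>: "finite \<Lambda>" "card \<Lambda> \<le> N" "\<And>L. L \<in> \<Lambda> \<Longrightarrow> plinear L"
    "\<And>f. f \<in> fat_polys (K - 1) s A (ms(j := ms j - 1)) \<Longrightarrow> (\<forall>L\<in>\<Lambda>. L f = 0) \<Longrightarrow> f = 0"
    using sep unfolding separated_def by blast
  define c where "c = [:of_nat j :: 'a:]"
  define \<Lambda>1 where "\<Lambda>1 = (\<lambda>L f. L (synthetic_div f c)) ` \<Lambda>"
  define \<Lambda>2 where "\<Lambda>2 = (\<lambda>t f. coeff (poly f c) t) ` T"
  show ?thesis
    unfolding separated_def
  proof (intro exI[of _ "\<Lambda>1 \<union> \<Lambda>2"] conjI ballI impI)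
    show "finite (\<Lambda>1 \<union> \<Lambda>2)" using \<Lambda> fin by (simp add: \<Lambda>1_def \<Lambda>2_def)
    have "card \<Lambda>1 \<le> card \<Lambda>" "card \<Lambda>2 \<le> card T"
      unfolding \<Lambda>1_def \<Lambda>2_def by (rule card_image_le; fact)+
    then show "card (\<Lambda>1 \<union> \<Lambda>2) \<le> N + card T"
      using card_Un_le[of \<Lambda>1 \<Lambda>2] \<Lambda>(2) by linarith
    show "plinear L" if "L \<in> \<Lambda>1 \<union> \<Lambda>2" for L
      using that \<Lambda>(3) by (auto simp: \<Lambda>1_def \<Lambda>2_def plinear_def synthetic_div_add synthetic_div_smult)
    fix f assume f: "f \<in> fat_polys K s A ms" and 0: "\<forall>L\<in>\<Lambda>1 \<union> \<Lambda>2. L f = 0"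
    have root: "poly f c = 0"
      using T[OF f] 0 by (simp add: \<Lambda>2_def c_def ball_Un)
    have "synthetic_div f c = 0"
      by (rule \<Lambda>(4)) (use fat_polys_synthetic_div[OF f _ j] root 0 in \<open>auto simp: \<Lambda>1_def c_def\<close>)
    then show "f = 0" using synthetic_div_root[OF root] by simp
  qed
qed

text \<open>A nonzero restriction has degree below K and at least s * ms j, by divisibility, so its
  leading coefficient has an index in that interval. Truncated subtraction makes the cost zero when
  the interval is empty.\<close>

lemma separated_step:
  fixes A :: "nat \<Rightarrow> nat \<Rightarrow> 'a::field_char_0"
  assumes "separated N (fat_polys (K - 1) s A (ms(j := ms j - 1)))" and j: "j < s"
    and inj: "inj_on (\<lambda>i. A i j) {..<s}"
  shows "separated (N + (K - s * ms j)) (fat_polys K s A ms)"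
proof -
  have "poly f [:of_nat j:] = 0"
    if f: "f \<in> fat_polys K s A ms" and 0: "\<forall>t\<in>{s * ms j..<K}. coeff (poly f [:of_nat j:]) t = 0" for f
  proof (rule ccontr)
    assume nz: "poly f [:of_nat j:] \<noteq> 0"
    have "degree ((\<Prod>i<s. [:-A i j, 1:]) ^ ms j) \<le> degree (poly f [:of_nat j:])"
      using fat_polys_restrict_dvd[OF f j inj] nz by (rule dvd_imp_degree_le)
    also have "degree ((\<Prod>i<s. [:-A i j, 1:]) ^ ms j) = s * ms j"
      by (simp add: degree_power_eq degree_prod_eq_sum_degree)
    finally have "s * ms j \<le> degree (poly f [:of_nat j:])" .
    moreover have "coeff (poly f [:of_nat j:]) (degree (poly f [:of_nat j:])) \<noteq> 0"
      using nz by simp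
    ultimately show False
      using 0 coeff_poly_const[of K f] f unfolding fat_polys_def
      by (metis (mono_tags, lifting) atLeastLessThan_iff linorder_not_less mem_Collect_eq)
  qed
  from separated_divide[OF assms(1) j this finite_atLeastLessThan] show ?thesis by simp
qed

lemma separated_lines:
  fixes A :: "nat \<Rightarrow> nat \<Rightarrow> 'a::field_char_0"
  assumes inj: "\<And>j. j < s \<Longrightarrow> inj_on (\<lambda>i. A i j) {..<s}"
    and "t \<le> s" "separated N (fat_polys (K - t) s A (\<lambda>j. if j < t then m - 1 else m))"
  shows "separated (N + (\<Sum>i<t. K - i - s * m)) (fat_polys K s A (\<lambda>_. m))"
  using assms(2,3)
proof (induction t arbitrary: N)
  case (Suc t)
  let ?ms = "\<lambda>j. if j < t then m - 1 else m"
  have "?ms(t := ?ms t - 1) = (\<lambda>j. if j < Suc t then m - 1 else m)" by (auto simp: fun_eq_iff)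
  with Suc.prems have "separated (N + (K - t - s * m)) (fat_polys (K - t) s A ?ms)"
    using separated_step[of N "K - t" s A ?ms t] inj by simp
  with Suc.IH Suc.prems show ?case by (force simp: algebra_simps)
qed simp

lemma separated_round:
  fixes A :: "nat \<Rightarrow> nat \<Rightarrow> 'a::field_char_0"
  assumes "\<And>j. j < s \<Longrightarrow> inj_on (\<lambda>i. A i j) {..<s}" "separated N (fat_polys (K - s) s A (\<lambda>_. m))"
  shows "separated (N + (\<Sum>i<s. K - i - s * Suc m)) (fat_polys K s A (\<lambda>_. Suc m))"
proof -
  \<comment> \<open>The two multiplicity functions agree below s, and \<open>fat_polys\<close> reads
    them only there.\<close>
  have "fat_polys (K - s) s A (\<lambda>_. m) = fat_polys (K - s) s A (\<lambda>j. if j < s then Suc m - 1 else Suc m)"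
    by (auto simp: fat_polys_def)
  with assms separated_lines[of s A s N K "Suc m"] show ?thesis by simp
qed

text \<open>Every line costs nothing when K is at most s * m, and a full pass preserves this
  inequality, until m = 0 forces K = 0.\<close>

lemma separated_empty_system:
  fixes A :: "nat \<Rightarrow> nat \<Rightarrow> 'a::field_char_0"
  assumes inj: "\<And>j. j < s \<Longrightarrow> inj_on (\<lambda>i. A i j) {..<s}" and "K \<le> s * m"
  shows "separated 0 (fat_polys K s A (\<lambda>_. m))"
  using assms(2)
proof (induction m arbitrary: K)
  case 0
  then have "\<forall>f\<in>fat_polys K s A (\<lambda>_. 0). f = 0" by (auto simp: fat_polys_def tdeg_less_0)
  then show ?case unfolding separated_def by (intro exI[of _ "{}"]) simp
next
  case (Suc m)
  then have "K - s \<le> s * m" by auto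
  from separated_round[OF inj Suc.IH[OF this]] Suc.prems show ?case by simp
qed

lemma Suc_choose_two: "Suc n choose 2 = n + (n choose 2)"
  by (simp add: numeral_2_eq_2)

text \<open>Lowering the degree bound from K to K - s removes the diagonals of K, ..., K - s + 1
  monomials from the triangle of exponents.\<close>

lemma choose_two_sum:
  "s \<le> K \<Longrightarrow> Suc K choose 2 = (Suc (K - s) choose 2) + (\<Sum>i<s. K - i)"
proof (induction s)
  case (Suc s)
  then have "Suc (K - s) choose 2 = (K - s) + (Suc (K - Suc s) choose 2)"
    by (simp add: Suc_choose_two Suc_diff_Suc)
  with Suc show ?case by simp
qed simp

text \<open>The inequality says that no difference K - i - s * m with i < s is truncated. Then the
  cost of one pass is exactly the change of the expected dimension, and the bound is sharp by
  induction on m.\<close>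

lemma separated_general:
  fixes A :: "nat \<Rightarrow> nat \<Rightarrow> 'a::field_char_0"
  assumes inj: "\<And>j. j < s \<Longrightarrow> inj_on (\<lambda>i. A i j) {..<s}" and "0 < s" "s * m + s \<le> Suc K"
  shows "\<exists>N. separated N (fat_polys K s A (\<lambda>_. m)) \<and> N + s * s * (Suc m choose 2) = Suc K choose 2"
  using assms(3)
proof (induction m arbitrary: K)
  case 0
  \<comment> \<open>With multiplicity 0 the line y = 0 can be divided out again and again, at cost
    K, K - 1, ..., 1.\<close>
  have "separated (Suc K choose 2) (fat_polys K s A (\<lambda>_. 0))" for K
  proof (induction K)
    case 0
    show ?case using separated_empty_system[of s A 0 0] inj by (simp add: numeral_2_eq_2)
  next
    case (Suc K)
    have upd: "(\<lambda>_::nat. 0::nat)(0 := 0) = (\<lambda>_. 0)" by auto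
    show ?case
      using separated_step[of "Suc K choose 2" "Suc K" s A "\<lambda>_. 0" 0] Suc \<open>0 < s\<close> inj
      by (simp add: upd Suc_choose_two[of "Suc K"] add.commute)
  qed
  then show ?case by (intro exI[of _ "Suc K choose 2"]) (simp add: numeral_2_eq_2)
next
  case (Suc m)
  have "s * m + s \<le> Suc (K - s)" using Suc.prems by simp
  from Suc.IH[OF this] obtain N where N: "separated N (fat_polys (K - s) s A (\<lambda>_. m))"
    "N + s * s * (Suc m choose 2) = Suc (K - s) choose 2" by blast
  let ?S = "\<Sum>i<s. K - i - s * Suc m"
  have "K - i = (K - i - s * Suc m) + s * Suc m" if "i < s" for i
    using Suc.prems that by simp
  then have "(\<Sum>i<s. K - i) = (\<Sum>i<s. (K - i - s * Suc m) + s * Suc m)"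
    by (intro sum.cong) auto
  also have "\<dots> = ?S + s * s * Suc m" by (simp only: sum.distrib) (simp add: algebra_simps)
  finally have "(\<Sum>i<s. K - i) = ?S + s * s * Suc m" .
  moreover have "s \<le> K" using Suc.prems by (cases s) auto
  moreover have "s * s * (Suc (Suc m) choose 2) = s * s * Suc m + s * s * (Suc m choose 2)"
    by (simp only: Suc_choose_two[of "Suc m"] distrib_left)
  ultimately have "N + ?S + s * s * (Suc (Suc m) choose 2) = Suc K choose 2"
    using N(2) choose_two_sum[of s K] by linarith
  then show ?case using separated_round[OF inj N(1)] by blast
qed

section \<open>The exceptional degree 3m for nine points\<close>

lemma coeff_prod_linear:
  fixes a :: "'b \<Rightarrow> 'a::field"
  assumes "finite I"
  shows "coeff (\<Prod>i\<in>I. [:-a i, 1:]) (card I) = 1"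
    and "0 < card I \<Longrightarrow> coeff (\<Prod>i\<in>I. [:-a i, 1:]) (card I - 1) = -(\<Sum>i\<in>I. a i)"
proof -
  have lc: "coeff (\<Prod>i\<in>I. [:-a i, 1:]) (card I) = 1" if "finite I" for I
  proof -
    have "degree (\<Prod>i\<in>I. [:-a i, 1:]) = card I" by (simp add: degree_prod_eq_sum_degree)
    then show ?thesis using lead_coeff_prod[of "\<lambda>i. [:-a i, 1:]" I] by simp
  qed
  then show "coeff (\<Prod>i\<in>I. [:-a i, 1:]) (card I) = 1" using assms by blast
  have "0 < card I \<longrightarrow> coeff (\<Prod>i\<in>I. [:-a i, 1:]) (card I - 1) = -(\<Sum>i\<in>I. a i)"
    using assms
  proof (induction I rule: finite_induct)
    case (insert x I)
    let ?P = "\<Prod>i\<in>I. [:-a i, 1:]"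
    have "(\<Prod>i\<in>insert x I. [:-a i, 1:]) = smult (- a x) ?P + pCons 0 ?P"
      using insert.hyps by simp
    then show ?case
      using insert lc[of I] by (cases "card I") auto
  qed simp
  then show "0 < card I \<Longrightarrow> coeff (\<Prod>i\<in>I. [:-a i, 1:]) (card I - 1) = -(\<Sum>i\<in>I. a i)" by blast
qed

text \<open>In total degree at most K + 1, the coefficient of x^(K+1) comes from y^0 alone and that
  of x^K from y^0 and y^1. On the line y = b the first is constant and the second affine in
  b.\<close>

lemma coeff_poly_const_top:
  assumes "tdeg_less (Suc (Suc K)) f"
  shows "coeff (poly f [:b:]) (Suc K) = coeff (coeff f 0) (Suc K)"
    and "coeff (poly f [:b:]) K = coeff (coeff f 0) K + b * coeff (coeff f 1) K"
proof -
  obtain a0 a1 g where f: "f = pCons a0 (pCons a1 g)" by (metis pCons_cases)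
  have a1: "coeff a1 (Suc K) = 0" and g: "tdeg_less K g"
    using assms by (auto simp: f tdeg_less_pCons)
  show "coeff (poly f [:b:]) (Suc K) = coeff (coeff f 0) (Suc K)"
    and "coeff (poly f [:b:]) K = coeff (coeff f 0) K + b * coeff (coeff f 1) K"
    using coeff_poly_const[OF g, of _ b] a1 by (auto simp: f)
qed

lemma fat_polys_three_lines_restrict:
  fixes A :: "nat \<Rightarrow> nat \<Rightarrow> 'a::field_char_0"
  assumes inj: "\<And>j. j < 3 \<Longrightarrow> inj_on (\<lambda>i. A i j) {..<3}"
    and sigma: "(\<Sum>i<3. A i 0) - 2 * (\<Sum>i<3. A i 1) + (\<Sum>i<3. A i 2) \<noteq> 0"
    and "0 < m" and f: "f \<in> fat_polys (Suc (3 * m)) 3 A (\<lambda>_. m)"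
  shows "poly f [:of_nat 0:] = 0"
proof -
  define w where "w j = (\<Prod>i<3. [:-A i j, 1:]) ^ m" for j
  define h where "h j = poly f [:of_nat j:]" for j
  \<comment> \<open>\<open>K\<close> is 3m - 1, so \<open>Suc K\<close> and \<open>K\<close> are the
    two top exponents of the restrictions.\<close>
  obtain K where K: "3 * m = Suc K" using \<open>0 < m\<close> by (metis gr0_implies_Suc mult_pos_pos zero_less_numeral)
  have deg: "tdeg_less (Suc (Suc K)) f" using f by (simp add: fat_polys_def K)
  have w: "coeff (w j) (Suc K) = 1" "coeff (w j) K = - (of_nat m * (\<Sum>i<3. A i j))"
    "degree (w j) = Suc K" for j
  proof -
    \<comment> \<open>Listing each root m times turns the power into a product of 3m linear factors,
      whose two top coefficients are known.\<close>
    have eq: "w j = (\<Prod>p\<in>{..<3}\<times>{..<m}. [:-A (fst p) j, 1:])"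
    proof -
      have "(\<Prod>p\<in>{..<3}\<times>{..<m}. [:-A (fst p) j, 1:]) = (\<Prod>i<3. \<Prod>k<m. [:-A i j, 1:])"
        unfolding prod.cartesian_product by (simp add: case_prod_unfold)
      then show ?thesis by (simp add: w_def prod_power_distrib)
    qed
    have card: "card ({..<3::nat}\<times>{..<m}) = Suc K" by (simp add: K)
    show "coeff (w j) (Suc K) = 1"
      using coeff_prod_linear(1)[of "{..<3}\<times>{..<m}" "\<lambda>p. A (fst p) j"] by (simp only: eq card) simp
    have "(\<Sum>p\<in>{..<3}\<times>{..<m}. A (fst p) j) = (\<Sum>i<3. \<Sum>k<m. A i j)"
      unfolding sum.cartesian_product by (simp add: case_prod_unfold)
    then have "(\<Sum>p\<in>{..<3}\<times>{..<m}. A (fst p) j) = of_nat m * (\<Sum>i<3. A i j)"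
      by (simp add: sum_distrib_left)
    then show "coeff (w j) K = - (of_nat m * (\<Sum>i<3. A i j))"
      using coeff_prod_linear(2)[of "{..<3}\<times>{..<m}" "\<lambda>p. A (fst p) j"] card
      by (simp only: eq) simp
    show "degree (w j) = Suc K"
      by (simp add: w_def degree_power_eq degree_prod_eq_sum_degree flip: K)
  qed
  have "\<exists>c. h j = smult c (w j)" if j: "j < 3" for j
  proof (cases "h j = 0")
    case False
    obtain q where q: "h j = w j * q"
      using fat_polys_restrict_dvd[OF f j inj[OF j]] by (auto simp: h_def w_def)
    have "degree (h j) \<le> Suc K"
      using coeff_poly_const[OF deg] unfolding h_def by (intro degree_le) auto
    moreover have "degree (h j) = Suc K + degree q"
      using False by (simp add: q degree_mult_eq w)
    ultimately have "degree q = 0" by simp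
    then obtain c where "q = [:c:]" by (rule degree_eq_zeroE)
    with q show ?thesis by auto
  qed auto
  then obtain c where c: "\<And>j. j < 3 \<Longrightarrow> h j = smult (c j) (w j)" by metis
  define d where "d = coeff (coeff f 0) (Suc K)"
  have cd: "c j = d" if "j < 3" for j
    using coeff_poly_const_top(1)[OF deg, of "of_nat j"] c[OF that] w(1)[of j] by (simp add: h_def d_def)
  have neg: "- (d * (of_nat m * (\<Sum>i<3. A i j))) = coeff (coeff f 0) K + of_nat j * coeff (coeff f 1) K"
    if "j < 3" for j
    using coeff_poly_const_top(2)[OF deg, of "of_nat j"] c[OF that] w(2)[of j] cd[OF that] by (simp add: h_def)
  define t where "t j = d * (of_nat m * (\<Sum>i<3. A i j))" for j
  have t: "t j = - (coeff (coeff f 0) K + of_nat j * coeff (coeff f 1) K)" if "j < 3" for j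
    using neg[OF that] unfolding t_def by (metis minus_minus)
  \<comment> \<open>The second difference annihilates the function \<open>t\<close>, which is affine
    in j.\<close>
  have "d * of_nat m * ((\<Sum>i<3. A i 0) - 2 * (\<Sum>i<3. A i 1) + (\<Sum>i<3. A i 2))
      = t 0 - 2 * t 1 + t 2"
    unfolding t_def by (simp only: distrib_left right_diff_distrib mult.assoc mult.left_commute)
  also have "\<dots> = 0" by (simp add: t)
  finally have "d * of_nat m * ((\<Sum>i<3. A i 0) - 2 * (\<Sum>i<3. A i 1) + (\<Sum>i<3. A i 2)) = 0" .
  then have "d = 0" using sigma \<open>0 < m\<close> by simp
  then show ?thesis using c[of 0] cd[of 0] by (simp add: h_def)
qed

lemma separated_multiple_cubic:
  fixes A :: "nat \<Rightarrow> nat \<Rightarrow> 'a::field_char_0"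
  assumes inj: "\<And>j. j < 3 \<Longrightarrow> inj_on (\<lambda>i. A i j) {..<3}"
    and sigma: "(\<Sum>i<3. A i 0) - 2 * (\<Sum>i<3. A i 1) + (\<Sum>i<3. A i 2) \<noteq> 0"
  shows "separated 1 (fat_polys (Suc (3 * m)) 3 A (\<lambda>_. m))"
proof (induction m)
  case 0
  have "(\<lambda>_::nat. 0::nat)(0 := 0 - 1) = (\<lambda>_. 0)" by auto
  with separated_empty_system[of 3 A 0 0] inj
  have "separated 0 (fat_polys (1 - 1) 3 A ((\<lambda>_. 0)(0 := 0 - 1)))"
    by simp
  from separated_step[OF this _ inj] show ?case by simp
next
  case (Suc m)
  let ?K = "3 * Suc m" and ?n = "Suc m"
  let ?m1 = "(\<lambda>_::nat. Suc m)(0 := m)"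
  let ?m2 = "?m1(1 := m)"
  have "fat_polys (?K - 2) 3 A (?m2(2 := m)) = fat_polys (Suc (3 * m)) 3 A (\<lambda>_. m)"
    by (auto simp: fat_polys_def numeral_3_eq_3 less_Suc_eq)
  with Suc have "separated 1 (fat_polys (?K - 1 - 1) 3 A (?m2(2 := ?m2 2 - 1)))"
    by (simp add: numeral_2_eq_2)
  from separated_step[OF this _ inj] have "separated 1 (fat_polys (?K - 1) 3 A ?m2)" by simp
  then have "separated 1 (fat_polys (?K - 1) 3 A (?m1(1 := ?m1 1 - 1)))" by simp
  from separated_step[OF this _ inj] have "separated 1 (fat_polys ?K 3 A ?m1)" by simp
  then have "separated 1 (fat_polys (Suc ?K - 1) 3 A ((\<lambda>_. ?n)(0 := ?n - 1)))" by simp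
  from separated_divide[OF this, of "{}"] show ?case
    using fat_polys_three_lines_restrict[OF inj sigma, of ?n] by simp
qed

section \<open>Macaulay duality\<close>

lemma finite_mdeg: "finite {m. mdeg m = k}"
  by (rule finite_subset[of _ "{..k} \<times> {..k} \<times> {..k}"]) (auto simp: mdeg_def)

lemma card_mdeg: "card {m. mdeg m = k} = (k + 2) choose 2"
proof -
  have eq: "{m. mdeg m = k} = (\<lambda>(a, b). (a, b, k - a - b)) ` (SIGMA a:{..k}. {..k - a})"
    by (auto simp: mdeg_def image_iff)
  have "card {m. mdeg m = k} = card (SIGMA a:{..k}. {..k - a})"
    unfolding eq by (rule card_image) (auto simp: inj_on_def)
  also have "\<dots> = (\<Sum>a<Suc k. Suc k - a)"
    by (simp add: lessThan_Suc_atMost Suc_diff_le)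
  also have "\<dots> = (k + 2) choose 2"
    using choose_two_sum[of "Suc k" "Suc k"] by (simp add: numeral_2_eq_2)
  finally show ?thesis .
qed

section \<open>Powers of linear forms\<close>

lemma pmul_mono:
  "pmul (mono (i, j, l)) g (a, b, c) = (if i \<le> a \<and> j \<le> b \<and> l \<le> c then g (a - i, b - j, c - l) else 0)"
proof -
  have "mono (i, j, l) (i', j', l') * x = (if i' = i then if j' = j then if l' = l then x else 0 else 0 else 0)"
    for i' j' l' and x :: 'a
    by (auto simp: mono_def)
  moreover have "(\<Sum>k\<le>c. if i' = i then if j' = j then if k = l then X else 0 else 0 else 0)
      = (if i' = i then if j' = j then if l \<le> c then X else 0 else 0 else 0)" for i' j' and X :: 'a
    by simp
  moreover have "(\<Sum>j'\<le>b. if i' = i then if j' = j then X else 0 else 0)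
      = (if i' = i then if j \<le> b then X else 0 else 0)" for i' and X :: 'a
    by simp
  ultimately show ?thesis
    by (simp add: pmul_def cong: if_cong)
qed

lemma pmul_linform:
  "pmul (linform (x, y, z)) g (a, b, c) =
     x * (if 1 \<le> a then g (a - 1, b, c) else 0) + y * (if 1 \<le> b then g (a, b - 1, c) else 0)
     + z * (if 1 \<le> c then g (a, b, c - 1) else 0)"
proof -
  have "linform (x, y, z) m = x * mono (1, 0, 0) m + y * mono (0, 1, 0) m + z * mono (0, 0, 1) m" for m
    by (auto simp: linform_def mono_def)
  then have "pmul (linform (x, y, z)) g (a, b, c) =
      x * pmul (mono (1, 0, 0)) g (a, b, c) + y * pmul (mono (0, 1, 0)) g (a, b, c)
      + z * pmul (mono (0, 0, 1)) g (a, b, c)"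
    by (simp add: pmul_def distrib_right sum.distrib sum_distrib_left mult.assoc)
  then show ?thesis by (simp only: pmul_mono) simp
qed

lemma lpow_coeff:
  fixes x y z :: "'a::field_char_0"
  shows "lpow (x, y, z) r (a, b, c) =
    (if a + b + c = r then fact r / (fact a * fact b * fact c) * x ^ a * y ^ b * z ^ c else 0)"
proof (induction r arbitrary: a b c)
  case 0
  then show ?case by (auto simp: lpow_def pone_def)
next
  case (Suc r)
  have rec: "lpow (x, y, z) (Suc r) = pmul (linform (x, y, z)) (lpow (x, y, z) r)"
    by (simp add: lpow_def)
  \<comment> \<open>\<open>F\<close> has \<open>fact r\<close> in the numerator. The three
    predecessors of the exponent contribute a, b and c times \<open>F\<close>, and a + b + c = r + 1
    completes the factorial.\<close>
  define F where "F = fact r / (fact a * fact b * fact c) * x ^ a * y ^ b * z ^ c"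
  have 1: "x * (if 1 \<le> a then lpow (x, y, z) r (a - 1, b, c) else 0)
      = (if a + b + c = Suc r then of_nat a * F else 0)"
    unfolding Suc F_def by (cases a) (auto simp: field_simps simp del: of_nat_Suc)
  have 2: "y * (if 1 \<le> b then lpow (x, y, z) r (a, b - 1, c) else 0)
      = (if a + b + c = Suc r then of_nat b * F else 0)"
    unfolding Suc F_def by (cases b) (auto simp: field_simps simp del: of_nat_Suc)
  have 3: "z * (if 1 \<le> c then lpow (x, y, z) r (a, b, c - 1) else 0)
      = (if a + b + c = Suc r then of_nat c * F else 0)"
    unfolding Suc F_def by (cases c) (auto simp: field_simps simp del: of_nat_Suc)
  have "lpow (x, y, z) (Suc r) (a, b, c) = (if a + b + c = Suc r then of_nat a * F + of_nat b * F + of_nat c * F else 0)"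
    unfolding rec pmul_linform 1 2 3 by simp
  moreover have "of_nat a * F + of_nat b * F + of_nat c * F = of_nat (a + b + c) * F"
    by (simp add: distrib_right)
  ultimately show ?case by (auto simp: F_def simp del: of_nat_add)
qed

text \<open>One linear factor is moved from the power to the monomial.\<close>

lemma pmul_mono_lpow_Suc:
  "pmul (mono (i, j, l)) (lpow (x, y, z) (Suc n)) m =
     x * pmul (mono (Suc i, j, l)) (lpow (x, y, z) n) m
     + y * pmul (mono (i, Suc j, l)) (lpow (x, y, z) n) m
     + z * pmul (mono (i, j, Suc l)) (lpow (x, y, z) n) m"
proof -
  obtain a b c where m: "m = (a, b, c)" by (cases m)
  have rec: "lpow (x, y, z) (Suc n) = pmul (linform (x, y, z)) (lpow (x, y, z) n)"
    by (simp add: lpow_def)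
  show ?thesis
    unfolding m rec pmul_mono pmul_linform by (auto simp: Suc_le_eq)
qed

section \<open>Functionals on forms and their dual polynomials\<close>

definition pairing :: "'a::field form \<Rightarrow> nat \<Rightarrow> 'a form \<Rightarrow> 'a" where
  "pairing \<Phi> k g = (\<Sum>m | mdeg m = k. \<Phi> m * g m)"

text \<open>A functional that kills the degree k part of the ideal of p^r kills that of p^n for n at
  least r, since the second ideal is contained in the first.\<close>

lemma pairing_lpow_mono_exponent:
  assumes gen: "\<And>i j l. i + j + l + r = k \<Longrightarrow> pairing \<Phi> k (pmul (mono (i, j, l)) (lpow (x, y, z) r)) = 0"
    and "r \<le> n"
  shows "i + j + l + n = k \<Longrightarrow> pairing \<Phi> k (pmul (mono (i, j, l)) (lpow (x, y, z) n)) = 0"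
  using \<open>r \<le> n\<close>
proof (induction n arbitrary: i j l rule: dec_induct)
  case base
  then show ?case by (rule gen)
next
  case (step n)
  have "pairing \<Phi> k (pmul (mono (i, j, l)) (lpow (x, y, z) (Suc n))) =
     x * pairing \<Phi> k (pmul (mono (Suc i, j, l)) (lpow (x, y, z) n))
     + y * pairing \<Phi> k (pmul (mono (i, Suc j, l)) (lpow (x, y, z) n))
     + z * pairing \<Phi> k (pmul (mono (i, j, Suc l)) (lpow (x, y, z) n))"
    by (simp add: pairing_def pmul_mono_lpow_Suc distrib_left sum.distrib sum_distrib_left mult.left_commute)
  with step show ?case by simp
qed

text \<open>The element of Macaulay's inverse system belonging to the functional with value \<Phi> m
  on the monomial m, dehomogenised at z = 1. The factorials convert between monomials and Taylor
  coefficients.\<close>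

definition dual_poly :: "nat \<Rightarrow> 'a::field_char_0 form \<Rightarrow> 'a poly poly" where
  "dual_poly k \<Phi> = (\<Sum>(a, b, c) | mdeg (a, b, c) = k.
     monom (monom (\<Phi> (a, b, c) / (fact a * fact b * fact c)) a) b)"

lemma coeff_dual_poly:
  "coeff (coeff (dual_poly k \<Phi>) b) a =
     (if a + b \<le> k then \<Phi> (a, b, k - a - b) / (fact a * fact b * fact (k - a - b)) else 0)"
proof -
  have "coeff (coeff (dual_poly k \<Phi>) b) a = (\<Sum>m | mdeg m = k.
      if m = (a, b, k - a - b) then \<Phi> m / (fact a * fact b * fact (k - a - b)) else 0)"
    unfolding dual_poly_def coeff_sum
    by (intro sum.cong) (auto simp: coeff_monom mdeg_def split: if_splits)
  also have "\<dots> = (if mdeg (a, b, k - a - b) = k then \<Phi> (a, b, k - a - b) / (fact a * fact b * fact (k - a - b)) else 0)"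
    by (subst sum.delta[OF finite_mdeg]) auto
  finally show ?thesis by (auto simp: mdeg_def)
qed

lemma tdeg_less_dual_poly: "tdeg_less (Suc k) (dual_poly k \<Phi>)"
  by (simp add: tdeg_less_def coeff_dual_poly)

text \<open>Dehomogenising loses nothing, as the third exponent is determined by the degree
  k.\<close>

lemma dual_poly_eq_0D:
  assumes "dual_poly k \<Phi> = 0" "mdeg m = k"
  shows "\<Phi> m = 0"
proof -
  obtain a b c where m: "m = (a, b, c)" by (cases m)
  then have "c = k - a - b" "a + b \<le> k" using assms(2) by (auto simp: mdeg_def)
  then show ?thesis
    using coeff_dual_poly[of k \<Phi> b a] assms(1) by (simp add: m)
qed

lemma pcompose_monom_eq: "monom c n \<circ>\<^sub>p q = smult c (q ^ n)" for q :: "'a::comm_ring_1 poly"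
  by (induction n) (simp_all add: monom_0 monom_Suc pcompose_pCons mult.commute)

lemma dvd_linear_power_if_coeff:
  fixes h :: "'a::field poly"
  assumes "\<And>i. i < n \<Longrightarrow> coeff (h \<circ>\<^sub>p [:a, 1:]) i = 0"
  shows "[:-a, 1:] ^ n dvd h"
proof -
  obtain q where q: "h \<circ>\<^sub>p [:a, 1:] = monom 1 n * q"
    using assms monom_1_dvd_iff'[of n "h \<circ>\<^sub>p [:a, 1:]"] by (auto elim: dvdE)
  have pow: "monom 1 n \<circ>\<^sub>p [:-a, 1:] = [:-a, 1:] ^ n"
    by (simp add: pcompose_monom_eq)
  have "h = h \<circ>\<^sub>p ([:a, 1:] \<circ>\<^sub>p [:-a, 1:])" by (simp add: pcompose_pCons)
  also have "\<dots> = [:-a, 1:] ^ n * (q \<circ>\<^sub>p [:-a, 1:])"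
    by (simp only: pcompose_assoc q pcompose_mult pow)
  finally show ?thesis by (rule dvdI)
qed

lemma coeff_shift_power:
  "coeff ([:y, 1:] ^ n) i = of_nat (n choose i) * y ^ (n - i)" for y :: "'a::idom"
proof (cases "i \<le> n")
  case False
  then have "coeff ([:y, 1:] ^ n) i = 0" by (intro coeff_eq_0) (simp add: degree_linear_power)
  with False show ?thesis by (simp add: binomial_eq_0)
qed (simp add: coeff_linear_poly_power)

lemma taylor_coeff_dual_poly:
  "coeff (coeff (dual_poly k \<Phi> \<circ>\<^sub>p [:[:y:], 1:]) j \<circ>\<^sub>p [:x, 1:]) i =
    (\<Sum>(a, b, c) | mdeg (a, b, c) = k. \<Phi> (a, b, c) / (fact a * fact b * fact c)
       * (of_nat (a choose i) * x ^ (a - i)) * (of_nat (b choose j) * y ^ (b - j)))"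
proof -
  have monom: "coeff (coeff (monom (monom d a) b \<circ>\<^sub>p [:[:y:], 1:]) j \<circ>\<^sub>p [:x, 1:]) i
      = d * (of_nat (a choose i) * x ^ (a - i)) * (of_nat (b choose j) * y ^ (b - j))" for d a b
  proof -
    have "coeff (monom (monom d a) b \<circ>\<^sub>p [:[:y:], 1:]) j
        = monom d a * [:of_nat (b choose j) * y ^ (b - j):]"
      by (simp add: pcompose_monom_eq coeff_shift_power poly_const_pow of_nat_poly mult.commute)
    then show ?thesis
      by (simp add: pcompose_smult pcompose_monom_eq coeff_shift_power mult.commute)
  qed
  show ?thesis
    unfolding dual_poly_def pcompose_sum coeff_sum
    by (intro sum.cong refl) (auto simp: monom)
qed

text \<open>Apolarity: up to factorials, the Taylor coefficient of index (i, j) at (x, y) is the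
  functional applied to X^i Y^j times the power k - i - j of the linear form with coefficients (x,
  y, 1). The binomials of the shift cancel against the multinomial coefficients.\<close>

lemma taylor_coeff_dual_poly_pairing:
  assumes "i + j \<le> k"
  shows "coeff (coeff (dual_poly k \<Phi> \<circ>\<^sub>p [:[:y:], 1:]) j \<circ>\<^sub>p [:x, 1:]) i * (fact i * fact j * fact (k - i - j))
    = pairing \<Phi> k (pmul (mono (i, j, 0)) (lpow (x, y, 1) (k - i - j)))"
  unfolding taylor_coeff_dual_poly pairing_def sum_distrib_right
proof (intro sum.cong, goal_cases)
  case 1
  show ?case by auto
next
  case (2 m)
  obtain a b c where m: "m = (a, b, c)" by (cases m)
  with 2 have md: "mdeg (a, b, c) = k" by simp
  then have k: "k = a + b + c" by (simp add: mdeg_def)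
  have "\<Phi> (a, b, c) / (fact a * fact b * fact c) * (of_nat (a choose i) * x ^ (a - i))
      * (of_nat (b choose j) * y ^ (b - j)) * (fact i * fact j * fact (k - i - j))
    = \<Phi> (a, b, c) * pmul (mono (i, j, 0)) (lpow (x, y, 1) (k - i - j)) (a, b, c)"
  proof (cases "i \<le> a \<and> j \<le> b")
    case True
    then have ch: "of_nat (a choose i) = (fact a / (fact i * fact (a - i)) :: 'a)"
      "of_nat (b choose j) = (fact b / (fact j * fact (b - j)) :: 'a)"
      by (simp_all add: binomial_fact)
    have "a - i + (b - j) + c = k - i - j" using True k by auto
    with True show ?thesis
      unfolding pmul_mono lpow_coeff ch by (simp add: field_simps)
  next
    case False
    then show ?thesis unfolding pmul_mono by (auto simp: binomial_eq_0)
  qed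
  then show ?case by (simp add: m)
qed

text \<open>The Taylor coefficients to be killed have i + j at most k - r, that is, k - i - j at
  least r; hence the multiplicity k - r + 1.\<close>

lemma vanish_dual_poly:
  assumes gen: "\<And>i j l. i + j + l + r = k \<Longrightarrow> pairing \<Phi> k (pmul (mono (i, j, l)) (lpow (x, y, 1) r)) = 0"
    and "r \<le> k"
  shows "vanish (k - r + 1) x y (dual_poly k \<Phi>)"
  unfolding vanish_def
proof (intro allI impI dvd_linear_power_if_coeff)
  fix i j assume "j < k - r + 1" "i < k - r + 1 - j"
  then have ij: "i + j \<le> k" "r \<le> k - i - j" using \<open>r \<le> k\<close> by auto
  have "pairing \<Phi> k (pmul (mono (i, j, 0)) (lpow (x, y, 1) (k - i - j))) = 0"
    by (rule pairing_lpow_mono_exponent[OF gen ij(2)]) (use ij in auto)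
  with taylor_coeff_dual_poly_pairing[OF ij(1), of \<Phi> y x]
  show "coeff (coeff (dual_poly k \<Phi> \<circ>\<^sub>p [:[:y:], 1:]) j \<circ>\<^sub>p [:x, 1:]) i = 0" by simp
qed

section \<open>The generic Hilbert function\<close>

interpretation form: vector_space "fscale :: 'a::field \<Rightarrow> 'a form \<Rightarrow> 'a form"
  by (rule vector_space_fscale)

interpretation form_functional: vector_space_pair "fscale :: 'a::field \<Rightarrow> 'a form \<Rightarrow> 'a form" "(*) :: 'a \<Rightarrow> 'a \<Rightarrow> 'a"
  by (intro vector_space_pair.intro vector_space_fscale) (unfold_locales, auto simp: algebra_simps)

text \<open>A vector outside the span extends a maximal independent subset of B, and a functional
  may be prescribed freely on independent vectors.\<close>

lemma exists_annihilating_functional: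
  fixes v :: "'a::field form"
  assumes "v \<notin> form.span B"
  obtains \<phi> where "Vector_Spaces.linear fscale (*) \<phi>" "\<phi> v = 1" "\<And>b. b \<in> B \<Longrightarrow> \<phi> b = 0"
proof -
  obtain B0 where B0: "B0 \<subseteq> B" "form.independent B0" "B \<subseteq> form.span B0"
    by (rule form.maximal_independent_subset)
  have v: "v \<notin> form.span B0" using B0(1) assms form.span_mono by blast
  then have "form.independent (insert v B0)" using B0(2) by (rule form.independent_insertI)
  from form_functional.linear_independent_extend[OF this, of "\<lambda>x. if x = v then 1 else 0"]
  obtain \<phi> where lin: "Vector_Spaces.linear fscale (*) \<phi>"
    and \<phi>: "\<forall>x\<in>insert v B0. \<phi> x = (if x = v then 1 else 0)" by blast
  have "v \<notin> B0" using v form.span_base by blast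
  then have "\<phi> b = 0" if "b \<in> B0" for b using \<phi> that by auto
  then have "\<phi> b = 0" if "b \<in> B" for b
    using form_functional.linear_eq_0_on_span[OF lin] B0(3) that by blast
  then show thesis using lin \<phi> that by auto
qed

lemma sum_form_apply: "(\<Sum>i\<in>I. F i) m = (\<Sum>i\<in>I. F i m)" for F :: "'b \<Rightarrow> 'a::field form"
  by (induction I rule: infinite_finite_induct) auto

lemma linear_functional_eq_pairing:
  assumes lin: "Vector_Spaces.linear fscale (*) \<phi>" and g: "\<And>m. mdeg m \<noteq> k \<Longrightarrow> g m = 0"
  shows "\<phi> g = pairing (\<lambda>m. \<phi> (mono m)) k g"
proof -
  have "g = (\<Sum>m | mdeg m = k. fscale (g m) (mono m))"
  proof
    fix m'
    have "(\<Sum>m | mdeg m = k. fscale (g m) (mono m)) m' = (\<Sum>m | mdeg m = k. if m' = m then g m else 0)"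
      by (simp add: sum_form_apply fscale_def mono_def if_distrib cong: if_cong)
    also have "\<dots> = g m'" using g[of m'] by (simp add: sum.delta' finite_mdeg)
    finally show "g m' = (\<Sum>m | mdeg m = k. fscale (g m) (mono m)) m'" ..
  qed
  then have "\<phi> g = \<phi> (\<Sum>m | mdeg m = k. fscale (g m) (mono m))" by (rule arg_cong)
  also have "\<dots> = (\<Sum>m | mdeg m = k. g m * \<phi> (mono m))"
    by (simp add: form_functional.linear_sum[OF lin] form_functional.linear_scale[OF lin])
  finally show ?thesis by (simp add: pairing_def mult.commute)
qed

lemma plinear_sum: "plinear L \<Longrightarrow> L (\<Sum>i\<in>I. f i) = (\<Sum>i\<in>I. L (f i))"
proof (induction I rule: infinite_finite_induct)
  case (infinite I)
  then have "L (smult [:0:] 0) = 0 * L 0" unfolding plinear_def by blast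
  then show ?case using infinite by simp
next
  case empty
  then have "L (smult [:0:] 0) = 0 * L 0" unfolding plinear_def by blast
  then show ?case by simp
qed (simp add: plinear_def)

lemma dual_poly_expand:
  "dual_poly k \<Phi> = (\<Sum>m | mdeg m = k. smult [:\<Phi> m:] (dual_poly k (mono m)))"
proof (intro poly_eqI)
  fix b a
  show "coeff (coeff (dual_poly k \<Phi>) b) a
    = coeff (coeff (\<Sum>m | mdeg m = k. smult [:\<Phi> m:] (dual_poly k (mono m))) b) a"
  proof (cases "a + b \<le> k")
    case True
    have "(\<Sum>m | mdeg m = k. \<Phi> m * mono m (a, b, k - a - b))
        = (\<Sum>m | mdeg m = k. if (a, b, k - a - b) = m then \<Phi> m else 0)"
      by (simp add: mono_def if_distrib cong: if_cong)
    also have "\<dots> = \<Phi> (a, b, k - a - b)"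
      using True by (subst sum.delta'[OF finite_mdeg]) (auto simp: mdeg_def)
    finally show ?thesis
      using True by (simp add: coeff_sum coeff_dual_poly flip: sum_divide_distrib)
  qed (simp add: coeff_sum coeff_dual_poly)
qed

text \<open>A functional on polynomials, composed with \<open>dual_poly\<close>, is pairing with a
  fixed form. Separating functionals thus become additional forms in degree k.\<close>

lemma plinear_dual_poly:
  assumes "plinear L"
  shows "L (dual_poly k \<Phi>) = (\<Sum>m | mdeg m = k. \<Phi> m * L (dual_poly k (mono m)))"
proof -
  have smult: "L (smult [:c:] f) = c * L f" for c f using assms unfolding plinear_def by blast
  have "L (dual_poly k \<Phi>) = L (\<Sum>m | mdeg m = k. smult [:\<Phi> m:] (dual_poly k (mono m)))"
    by (rule arg_cong[OF dual_poly_expand])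
  then show ?thesis by (simp only: plinear_sum[OF assms] smult)
qed

lemma gens_nat:
  assumes "r \<le> k"
  shows "gens p l (int r) k =
    (\<lambda>(m, i). pmul (mono m) (lpow (p i) r)) ` ({m. mdeg m = k - r} \<times> {..<l})"
  using assms by (auto simp: gens_def)

lemma finite_gens: "r \<le> k \<Longrightarrow> finite (gens p l (int r) k)"
  by (simp add: gens_nat finite_mdeg)

lemma gens_homogeneous:
  fixes p :: "nat \<Rightarrow> 'a::field_char_0 \<times> 'a \<times> 'a"
  assumes "r \<le> k" "g \<in> gens p l (int r) k" "mdeg m \<noteq> k"
  shows "g m = 0"
proof -
  obtain m' i where g: "g = pmul (mono m') (lpow (p i) r)" "mdeg m' = k - r"
    using assms(1,2) by (auto simp: gens_nat)
  obtain a b c a' b' c' x y z where "m = (a, b, c)" "m' = (a', b', c')" "p i = (x, y, z)"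
    by (metis prod_cases3)
  note m = this
  show ?thesis using g(2) assms(1,3) unfolding g(1) m by (auto simp: pmul_mono lpow_coeff mdeg_def)
qed

lemma independent_mono: "form.independent (mono ` M :: 'a::field form set)"
proof -
  have "v \<notin> form.span (mono ` M - {v})" if "v \<in> mono ` M" for v :: "'a form"
  proof
    obtain m where v: "v = mono m" using \<open>v \<in> mono ` M\<close> by blast
    assume "v \<in> form.span (mono ` M - {v})"
    then have "v m = 0"
    proof (rule form.span_induct)
      show "form.subspace {g. g m = (0::'a)}"
        by (auto simp: form.subspace_def fscale_def)
    qed (auto simp: v mono_def)
    then show False by (simp add: v mono_def)
  qed
  then show ?thesis unfolding form.dependent_def by blast
qed

text \<open>G may be replaced by a basis of its span; the independent monomials of degree k cannot
  outnumber the spanning set that results.\<close>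

lemma card_le_dim_plus:
  assumes "finite (G :: 'a::field form set)" "finite V" "mono ` {m. mdeg m = k} \<subseteq> form.span (G \<union> V)"
  shows "(k + 2) choose 2 \<le> form.dim G + card V"
proof -
  obtain B where B: "B \<subseteq> G" "form.independent B" "G \<subseteq> form.span B" "card B = form.dim G"
    by (rule form.basis_exists)
  have fin: "finite B" using B(1) assms(1) by (rule finite_subset)
  have "G \<union> V \<subseteq> form.span (B \<union> V)"
    using B(3) form.span_mono[of B "B \<union> V"] form.span_superset[of "B \<union> V"] by auto
  then have "form.span (G \<union> V) \<subseteq> form.span (B \<union> V)"
    by (rule form.span_minimal) (rule form.subspace_span)
  with assms(3) have "mono ` {m. mdeg m = k} \<subseteq> form.span (B \<union> V)" by (rule order_trans)
  from form.independent_span_bound[OF _ independent_mono this]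
  have "card (mono ` {m. mdeg m = k} :: 'a form set) \<le> card (B \<union> V)"
    using fin assms(2) by simp
  also have "card (mono ` {m. mdeg m = k} :: 'a form set) = (k + 2) choose 2"
  proof (subst card_image)
    show "inj_on (mono :: _ \<Rightarrow> 'a form) {m. mdeg m = k}"
      by (rule inj_onI) (metis mono_def zero_neq_one)
  qed (rule card_mdeg)
  also have "card (B \<union> V) \<le> form.dim G + card V" using card_Un_le[of B V] B(4) by simp
  finally show ?thesis .
qed

text \<open>The generators and at most N further forms span all forms of degree k. Otherwise some
  functional kills them but not a monomial; its dual polynomial has the prescribed multiplicities,
  is killed by all of \<Lambda>, and so is zero, a contradiction.\<close>

lemma hpts_le_if_separated:
  fixes x y :: "nat \<Rightarrow> 'a::field_char_0"
  assumes "r \<le> k" and sep: "separated N {f. tdeg_less (Suc k) f \<and> (\<forall>i<l. vanish (k - r + 1) (x i) (y i) f)}"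
  shows "hpts (\<lambda>i. (x i, y i, 1)) l (int r) k \<le> N"
proof -
  define G where "G = gens (\<lambda>i. (x i, y i, 1)) l (int r) k"
  obtain \<Lambda> where \<Lambda>: "finite \<Lambda>" "card \<Lambda> \<le> N" "\<And>L. L \<in> \<Lambda> \<Longrightarrow> plinear L"
    "\<And>f. tdeg_less (Suc k) f \<Longrightarrow> (\<forall>i<l. vanish (k - r + 1) (x i) (y i) f) \<Longrightarrow> (\<forall>L\<in>\<Lambda>. L f = 0) \<Longrightarrow> f = 0"
    using sep unfolding separated_def by blast
  \<comment> \<open>Each L becomes the form whose pairing with \<Phi> is
    \<open>L (dual_poly k \<Phi>)\<close>.\<close>
  define V where "V = (\<lambda>L m. if mdeg m = k then L (dual_poly k (mono m)) else 0) ` \<Lambda>"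
  have "mono m \<in> form.span (G \<union> V)" if m: "mdeg m = k" for m
  proof (rule ccontr)
    assume "mono m \<notin> form.span (G \<union> V)"
    then obtain \<phi> where \<phi>: "Vector_Spaces.linear fscale (*) \<phi>" "\<phi> (mono m) = 1"
      "\<And>b. b \<in> G \<union> V \<Longrightarrow> \<phi> b = 0" by (rule exists_annihilating_functional) blast
    define \<Phi> where "\<Phi> = (\<lambda>m. \<phi> (mono m))"
    have "pairing \<Phi> k (pmul (mono (a, b, c)) (lpow (x i, y i, 1) r)) = 0"
      if "i < l" "a + b + c + r = k" for i a b c
    proof -
      let ?g = "pmul (mono (a, b, c)) (lpow (x i, y i, 1) r)"
      have g: "?g \<in> gens (\<lambda>i. (x i, y i, 1)) l (int r) k"
        using that unfolding gens_nat[OF assms(1)] by (force simp: mdeg_def)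
      then have "\<phi> ?g = 0" using \<phi>(3) by (simp add: G_def)
      moreover have "\<phi> ?g = pairing (\<lambda>m. \<phi> (mono m)) k ?g"
        by (rule linear_functional_eq_pairing[OF \<phi>(1)]) (rule gens_homogeneous[OF assms(1) g])
      ultimately show ?thesis by (simp add: \<Phi>_def)
    qed
    then have "\<forall>i<l. vanish (k - r + 1) (x i) (y i) (dual_poly k \<Phi>)"
      by (intro allI impI vanish_dual_poly assms(1))
    moreover have "L (dual_poly k \<Phi>) = 0" if "L \<in> \<Lambda>" for L
    proof -
      define v where "v = (\<lambda>m. if mdeg m = k then L (dual_poly k (mono m)) else 0)"
      have "0 = \<phi> v" using \<phi>(3) that by (auto simp: V_def v_def)
      also have "\<dots> = pairing \<Phi> k v"
        using linear_functional_eq_pairing[OF \<phi>(1), of k v] by (simp add: v_def \<Phi>_def)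
      also have "\<dots> = L (dual_poly k \<Phi>)"
        by (simp add: plinear_dual_poly[OF \<Lambda>(3)[OF that], of k \<Phi>] pairing_def v_def)
      finally show ?thesis by simp
    qed
    ultimately have "dual_poly k \<Phi> = 0" using \<Lambda>(4) tdeg_less_dual_poly by blast
    then have "\<Phi> m = 0" using m by (rule dual_poly_eq_0D)
    then show False using \<phi>(2) by (simp add: \<Phi>_def)
  qed
  then have "mono ` {m. mdeg m = k} \<subseteq> form.span (G \<union> V)" by auto
  moreover have "finite G" "finite V" using \<Lambda>(1) finite_gens[OF assms(1)] by (auto simp: G_def V_def)
  ultimately have "(k + 2) choose 2 \<le> form.dim G + card V" using card_le_dim_plus by blast
  moreover have "card V \<le> N" unfolding V_def using card_image_le[OF \<Lambda>(1)] \<Lambda>(2) le_trans by blast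
  ultimately show ?thesis by (simp add: hpts_def card_mdeg G_def)
qed

lemma cfun_le_hpts:
  fixes p :: "nat \<Rightarrow> 'a::field \<times> 'a \<times> 'a"
  assumes "r \<le> k"
  shows "cfun l (int r) k \<le> hpts p l (int r) k"
proof -
  let ?G = "gens p l (int r) k"
  have "form.dim ?G \<le> card ?G"
    by (rule form.dim_le_card) (simp_all add: form.span_superset finite_gens[OF assms])
  also have "\<dots> \<le> card ({m. mdeg m = k - r} \<times> {..<l})"
    unfolding gens_nat[OF assms] by (rule card_image_le) (simp add: finite_mdeg)
  also have "\<dots> = l * ((k - r + 2) choose 2)" by (simp add: card_cartesian_product card_mdeg)
  finally have "form.dim ?G \<le> l * ((k - r + 2) choose 2)" .
  moreover have "nat (int k - int r) = k - r" using assms by simp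
  ultimately show ?thesis
    using assms by (simp add: cfun_def hpts_def card_mdeg trunc_def nat_le_iff flip: of_nat_mult)
qed

text \<open>The lower bound holds for every configuration, so one that attains it gives the
  minimum.\<close>

lemma hgen_eq_cfunI:
  fixes p :: "nat \<Rightarrow> 'a::field \<times> 'a \<times> 'a"
  assumes "r \<le> k" "\<And>i. i < l \<Longrightarrow> p i \<noteq> (0, 0, 0)" "hpts p l (int r) k \<le> cfun l (int r) k"
  shows "hgen TYPE('a) l (int r) k = cfun l (int r) k"
proof -
  have "hpts p l (int r) k = cfun l (int r) k" using assms(3) cfun_le_hpts[OF assms(1)] by (rule antisym)
  then have "(LEAST n. \<exists>p :: nat \<Rightarrow> 'a \<times> 'a \<times> 'a. (\<forall>i<l. p i \<noteq> (0, 0, 0)) \<and> n = hpts p l (int r) k) = cfun l (int r) k"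
    using assms(2) by (intro Least_equality exI[of _ p]) (auto simp: cfun_le_hpts[OF assms(1)])
  then show ?thesis by (simp add: hgen_def)
qed

text \<open>The exceptional point \<open>(3, 2)\<close> makes the second difference of the abscissa sums nonzero.\<close>

definition gridx :: "nat \<Rightarrow> nat \<Rightarrow> 'a::field_char_0" where
  "gridx i j = of_nat (if i = 2 \<and> j = 2 then 3 else i)"

lemma inj_gridx: "inj_on (\<lambda>i. gridx i j :: 'a::field_char_0) {..<s}" if "s \<le> 3"
proof (rule inj_onI)
  fix a b assume ab: "a \<in> {..<s}" "b \<in> {..<s}" "gridx a j = (gridx b j :: 'a)"
  then have "(if a = 2 \<and> j = 2 then 3 else a) = (if b = 2 \<and> j = 2 then 3 else b)"
    by (simp only: gridx_def of_nat_eq_iff)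
  with ab(1,2) that show "a = b" by (simp split: if_splits)
qed

lemma separated_grid:
  assumes "s = 2 \<or> s = 3"
  shows "\<exists>N. separated N (fat_polys (Suc k) s (gridx :: nat \<Rightarrow> nat \<Rightarrow> 'a::field_char_0) (\<lambda>_. m)) \<and>
    (N = 0 \<or> N + s * s * (Suc m choose 2) = (k + 2) choose 2)"
proof -
  have inj: "inj_on (\<lambda>i. gridx i j :: 'a) {..<s}" for j using assms inj_gridx by auto
  consider "Suc k \<le> s * m" | "s * m + s \<le> Suc (Suc k)" | "s = 3" "Suc k = Suc (3 * m)"
  proof -
    \<comment> \<open>The empty case ends at k = s * m - 1 and the general one starts at k = s * m +
      s - 2. For s = 2 there is no gap; for s = 3 only k = 3m lies between.\<close>
    have "Suc k \<le> s * m \<or> s * m + s \<le> Suc (Suc k) \<or> s = 3 \<and> k = 3 * m"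
      using assms by auto
    then show thesis using that by auto
  qed
  then show ?thesis
  proof cases
    case 1
    then show ?thesis using separated_empty_system[of s gridx "Suc k" m] inj by blast
  next
    case 2
    have "0 < s" using assms by auto
    then obtain N where "separated N (fat_polys (Suc k) s (gridx :: nat \<Rightarrow> nat \<Rightarrow> 'a) (\<lambda>_. m))"
      "N + s * s * (Suc m choose 2) = Suc (Suc k) choose 2"
      using separated_general[of s gridx m "Suc k"] inj 2 by blast
    then show ?thesis by auto
  next
    case 3
    have "(\<Sum>i<3. gridx i 0) - 2 * (\<Sum>i<3. gridx i 1) + (\<Sum>i<3. gridx i 2) = (1::'a)"
      by (simp add: gridx_def numeral_3_eq_3)
    then have "separated 1 (fat_polys (Suc (3 * m)) 3 (gridx :: nat \<Rightarrow> nat \<Rightarrow> 'a) (\<lambda>_. m))"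
      using separated_multiple_cubic[of "gridx :: nat \<Rightarrow> nat \<Rightarrow> 'a" m] inj 3 by simp
    \<comment> \<open>The bound 1 is the expected dimension in degree 3m.\<close>
    moreover have "1 + 3 * 3 * (Suc m choose 2) = (3 * m + 2) choose 2"
    proof (induction m)
      case (Suc m)
      have "3 * Suc m + 2 = Suc (Suc (Suc (3 * m + 2)))" by simp
      then have "(3 * Suc m + 2) choose 2 = 3 * (3 * m + 2) + 3 + ((3 * m + 2) choose 2)"
        by (simp only: Suc_choose_two) simp
      then show ?case
        unfolding Suc_choose_two[of "Suc m"] using Suc.IH by (simp add: algebra_simps)
    qed (simp add: numeral_2_eq_2)
    ultimately show ?thesis using 3 by auto
  qed
qed

lemma hgen_square:
  assumes s: "s = 2 \<or> s = 3" and "r \<le> k"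
  shows "hgen TYPE('a::field_char_0) (s * s) (int r) k = cfun (s * s) (int r) k"
proof -
  \<comment> \<open>The s * s points are numbered line by line: n is point n mod s on line n div
    s.\<close>
  define x y :: "nat \<Rightarrow> 'a" where "x n = gridx (n mod s) (n div s)" and "y n = of_nat (n div s)" for n
  obtain N where N: "separated N (fat_polys (Suc k) s (gridx :: nat \<Rightarrow> nat \<Rightarrow> 'a) (\<lambda>_. k - r + 1))"
    "N = 0 \<or> N + s * s * (Suc (k - r + 1) choose 2) = (k + 2) choose 2"
    using separated_grid[OF s] by blast
  have "{f. tdeg_less (Suc k) f \<and> (\<forall>n<s * s. vanish (k - r + 1) (x n) (y n) f)}
      = fat_polys (Suc k) s gridx (\<lambda>_. k - r + 1)"
  proof -
    have "(\<forall>n<s * s. vanish (k - r + 1) (x n) (y n) f)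
        \<longleftrightarrow> (\<forall>j<s. \<forall>i<s. vanish (k - r + 1) (gridx i j) (of_nat j) f)" for f
    proof (intro iffI allI impI)
      fix i j assume *: "\<forall>n<s * s. vanish (k - r + 1) (x n) (y n) f" "j < s" "i < s"
      have "i + s * j < s * Suc j" using *(3) by simp
      also have "\<dots> \<le> s * s" using *(2) by (intro mult_le_mono2) simp
      finally have "i + s * j < s * s" .
      then have "vanish (k - r + 1) (x (i + s * j)) (y (i + s * j)) f" using * by blast
      then show "vanish (k - r + 1) (gridx i j) (of_nat j) f" using * by (simp add: x_def y_def)
    next
      fix n assume *: "\<forall>j<s. \<forall>i<s. vanish (k - r + 1) (gridx i j) (of_nat j) f" "n < s * s"
      then have "n mod s < s" "n div s < s" using s by (auto simp: less_mult_imp_div_less)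
      with * show "vanish (k - r + 1) (x n) (y n) f" by (simp add: x_def y_def)
    qed
    then show ?thesis by (auto simp: fat_polys_def)
  qed
  with N(1) \<open>r \<le> k\<close> have "hpts (\<lambda>n. (x n, y n, 1)) (s * s) (int r) k \<le> N"
    by (intro hpts_le_if_separated) simp_all
  \<comment> \<open>A nonzero N is the exact difference of the binomials, so \<open>trunc\<close>
    returns it unchanged.\<close>
  also have "N \<le> cfun (s * s) (int r) k"
  proof (cases "N = 0")
    case False
    then have "int ((k + 2) choose 2) - int (s * s) * int ((k - r + 2) choose 2) = int N"
      using N(2) by (simp flip: of_nat_mult)
    moreover have "nat (int k - int r) = k - r" using \<open>r \<le> k\<close> by simp
    ultimately show ?thesis using \<open>r \<le> k\<close> by (simp add: cfun_def trunc_def)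
  qed simp
  finally have "hpts (\<lambda>n. (x n, y n, 1)) (s * s) (int r) k \<le> cfun (s * s) (int r) k" .
  from hgen_eq_cfunI[OF \<open>r \<le> k\<close> _ this] show ?thesis by simp
qed

text \<open>The left side is 0 by convention; on the right k - r exceeds k, so a single point
  already makes the difference nonpositive.\<close>

lemma hgen_negative: "r < 0 \<Longrightarrow> 0 < l \<Longrightarrow> hgen TYPE('a::field) l r k = cfun l r k"
proof -
  assume r: "r < 0" "0 < l"
  have "(k + 2) choose 2 \<le> (nat (int k - r) + 2) choose 2"
    by (rule binomial_right_mono) (use r in linarith)
  also have "\<dots> \<le> l * ((nat (int k - r) + 2) choose 2)" using r(2) by simp
  finally have "int ((k + 2) choose 2) \<le> int l * int ((nat (int k - r) + 2) choose 2)"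
    by (simp flip: of_nat_mult)
  then show ?thesis using r by (simp add: hgen_def cfun_def trunc_def)
qed

text \<open>There are no generators, so every configuration leaves the full space of forms.\<close>

lemma hgen_large: "int k < r \<Longrightarrow> hgen TYPE('a::field) l r k = cfun l r k"
proof -
  assume r: "int k < r"
  have "hpts p l r k = cfun l r k" for p :: "nat \<Rightarrow> 'a \<times> 'a \<times> 'a"
    using r form.dim_le_card[of "{} :: 'a form set" "{}"] by (simp add: hpts_def gens_def cfun_def card_mdeg)
  moreover have "\<exists>p :: nat \<Rightarrow> 'a \<times> 'a \<times> 'a. \<forall>i<l. p i \<noteq> (0, 0, 0)"
    by (intro exI[of _ "\<lambda>_. (1, 0, 0)"]) simp
  ultimately show ?thesis using r by (simp add: hgen_def Least_equality)
qed

theorem mainTheorem11: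
  fixes l :: nat
  assumes "l = 4 \<or> l = 9"
  shows "\<forall>(r::int) (k::nat).
           hgen TYPE('a::{alg_closed_field, field_char_0}) l r k = cfun l r k"
proof (intro allI)
  fix r :: int and k :: nat
  have "l = 2 * 2 \<or> l = 3 * 3" using assms by simp
  then obtain s where s: "s = 2 \<or> s = 3" "l = s * s" by blast
  consider "r < 0" | "int k < r" | n where "r = int n" "n \<le> k"
    using that(1,2) that(3)[of "nat r"] by linarith
  then show "hgen TYPE('a) l r k = cfun l r k"
  proof cases
    case 1
    then show ?thesis using assms by (intro hgen_negative) auto
  next
    case 2
    then show ?thesis by (rule hgen_large)
  next
    case 3
    then show ?thesis using hgen_square[OF s(1)] s(2) by simp
  qed
qed

end
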